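(* Let $N\ge 1$ be an integer, $\alpha\in(0,N)$, $p>0$, and let $g:[0,\infty)\to(0,\infty)$ be a non-increasing function of class $C^1(0,\infty)\cap C[0,\infty)$ with $\lim_{t\to 0^+}\frac{t g'(t)}{g(t)}=0$. Then for all $m>s>1$ and all $q>s-1$, the inequality $$ \mathcal L_g u+\Delta_s u\ \ge\ (|x|^{-\alpha}*u^p)\,u^q\qquad\text{in }\mathbb R^N\setminus\overline B_1 $$ has a positive solution.
   Context: $B_R$ is the open ball of radius $R$ centred at the origin in $\mathbb R^N$. $\Delta_s u=\operatorname{div}(|\nabla u|^{s-2}\nabla u)$ and $\mathcal L_g u=-\operatorname{div}\big(|\nabla u|^{m-2}g(|\nabla u|)\nabla u\big)$ (note the minus sign in $\mathcal L_g$). The convolution is taken over $\mathbb R^N\setminus B_1$: $(|x|^{-\alpha}*u^p)(x)=\int_{\mathbb R^N\setminus B_1}\frac{u^p(y)}{|x-y|^{\alpha}}\,dy$ for $x\in\mathbb R^N\setminus\overline B_1$. A positive solution of the inequality is a function $u\in C(\mathbb R^N\setminus\overline B_1)\cap W^{1,m}_{loc}(\mathbb R^N\setminus\overline B_1)$ with $u>0$, with $\int_{\mathbb R^N\setminus B_1}\frac{u^p(y)}{1+|y|^\alpha}\,dy<\infty$, and such that for every $\phi\in C_c^\infty(\mathbb R^N\setminus\overline B_1)$, $\phi\ge0$, $$ \int_{\mathbb R^N\setminus B_1}\Big(|\nabla u|^{m-2}g(|\nabla u|)-|\nabla u|^{s-2}\Big)\nabla u\cdot\nabla\phi\,dx\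 \ge\ \int_{\mathbb R^N\setminus B_1}(|x|^{-\alpha}*u^p)u^q\phi\,dx . $$ *)

theory Defs
  imports "HOL-Analysis.Analysis"
begin

definition gradient :: "('a::euclidean_space \<Rightarrow> real) \<Rightarrow> 'a \<Rightarrow> 'a" where
  "gradient f x = (THE D. GDERIV f x :> D)"

text \<open>\<open>C_diff k f\<close>: \<open>f\<close> is of class \<open>C\<^sup>k\<close> on the whole space.\<close>

primrec C_diff :: "nat \<Rightarrow> ('a::euclidean_space \<Rightarrow> real) \<Rightarrow> bool" where
  "C_diff 0 f \<longleftrightarrow> continuous_on UNIV f"
| "C_diff (Suc k) f \<longleftrightarrow>
     (\<forall>x. f differentiable (at x)) \<and> (\<forall>v. C_diff k (\<lambda>x. frechet_derivative f (at x) v))"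

text \<open>Elements of \<open>C\<^sub>c\<^sup>\<infinity>(\<Omega>)\<close> are represented by their extension by zero to the whole space.\<close>

definition test_function :: "'a::euclidean_space set \<Rightarrow> ('a \<Rightarrow> real) \<Rightarrow> bool" where
  "test_function \<Omega> \<phi> \<longleftrightarrow>
     (\<forall>k. C_diff k \<phi>) \<and> compact (closure {x. \<phi> x \<noteq> 0}) \<and> closure {x. \<phi> x \<noteq> 0} \<subseteq> \<Omega>"

definition L_loc :: "real \<Rightarrow> 'a::euclidean_space set \<Rightarrow> ('a \<Rightarrow> 'b::euclidean_space) \<Rightarrow> bool" where
  "L_loc r \<Omega> f \<longleftrightarrow> set_borel_measurable lebesgue \<Omega> f \<and>
     (\<forall>K. compact K \<and> K \<subseteq> \<Omega> \<longrightarrow> set_integrable lebesgue K (\<lambda>x. norm (f x) powr r))"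

definition weak_gradient :: "'a::euclidean_space set \<Rightarrow> ('a \<Rightarrow> real) \<Rightarrow> ('a \<Rightarrow> 'a) \<Rightarrow> bool" where
  "weak_gradient \<Omega> u Du \<longleftrightarrow> (\<forall>\<phi>. test_function \<Omega> \<phi> \<longrightarrow>
     (LINT x:\<Omega>|lebesgue. u x *\<^sub>R gradient \<phi> x) = - (LINT x:\<Omega>|lebesgue. \<phi> x *\<^sub>R Du x))"

text \<open>\<open>W1_loc r \<Omega> u Du\<close>: \<open>u\<close> belongs to the local Sobolev space \<open>W\<^sup>1\<^sup>,\<^sup>r(\<Omega>)\<close> and \<open>Du\<close> is a
  representative of its weak gradient, which is unique up to null sets.\<close>

definition W1_loc :: "real \<Rightarrow> 'a::euclidean_space set \<Rightarrow> ('a \<Rightarrow> real) \<Rightarrow> ('a \<Rightarrow> 'a) \<Rightarrow> bool" where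
  "W1_loc r \<Omega> u Du \<longleftrightarrow> L_loc r \<Omega> u \<and> L_loc r \<Omega> Du \<and> weak_gradient \<Omega> u Du"

definition ext_conv :: "real \<Rightarrow> real \<Rightarrow> ('a::euclidean_space \<Rightarrow> real) \<Rightarrow> 'a \<Rightarrow> real" where
  "ext_conv \<alpha> p u x = (LINT y:(- ball 0 1)|lebesgue. u y powr p / norm (x - y) powr \<alpha>)"

text \<open>Positive solutions of
    \<open>L\<^sub>g u + \<Delta>\<^sub>s u \<ge> (|x|\<^sup>-\<^sup>\<alpha> * u\<^sup>p) u\<^sup>q\<close>  outside the closed unit ball.
  A solution is a total function whose values on the closed unit ball are irrelevant (the unit
  sphere is a null set).  The terms \<open>|Du|\<^sup>m\<^sup>-\<^sup>2 Du\<close> and \<open>|Du|\<^sup>s\<^sup>-\<^sup>2 Du\<close> are \<open>0\<close> where \<open>Du = 0\<close>, also for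
  exponents below \<open>2\<close>.

  The integrals in the inequality converge absolutely as soon as the other clauses hold, if
  \<open>0 < \<alpha> < N\<close>, \<open>p, q > 0\<close>, \<open>1 < s < m\<close> and \<open>g\<close> is continuous and bounded on \<open>[0,\<infinity>)\<close>, so the
  convention that non-integrable functions have integral \<open>0\<close> plays no role:
  on the left, \<open>|Du|\<^sup>m\<^sup>-\<^sup>1\<close> and \<open>|Du|\<^sup>s\<^sup>-\<^sup>1\<close> are locally integrable; on the right, \<open>u\<^sup>p\<close> is locally
  bounded and \<open>u\<^sup>p / (1 + |y|\<^sup>\<alpha>)\<close> is integrable, so the convolution is finite and locally bounded.\<close>

definition positive_solution ::
  "real \<Rightarrow> real \<Rightarrow> real \<Rightarrow> real \<Rightarrow> real \<Rightarrow> (real \<Rightarrow> real) \<Rightarrow> ('a::euclidean_space \<Rightarrow> real) \<Rightarrow> bool" where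
  "positive_solution \<alpha> p q m s g u \<longleftrightarrow>
     continuous_on (- cball 0 1) u \<and>
     (\<forall>x \<in> - cball 0 1. u x > 0) \<and>
     set_integrable lebesgue (- ball 0 1) (\<lambda>y. u y powr p / (1 + norm y powr \<alpha>)) \<and>
     (\<exists>Du. W1_loc m (- cball 0 1) u Du \<and>
       (\<forall>\<phi>. test_function (- cball 0 1) \<phi> \<and> (\<forall>x. \<phi> x \<ge> 0) \<longrightarrow>
          (LINT x:(- ball 0 1)|lebesgue.
             (norm (Du x) powr (m - 2) * g (norm (Du x)) - norm (Du x) powr (s - 2))
               * (Du x \<bullet> gradient \<phi> x))
          \<ge> (LINT x:(- ball 0 1)|lebesgue. ext_conv \<alpha> p u x * u x powr q * \<phi> x)))"

end

(* The solution is u(x) = eps |x|^(-k) with k large and eps small.  As s < m, the s-Laplacian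
   dominates the m-Laplacian type term when the gradient is small (the term containing g' has the
   right sign because g is non-increasing), and for k large it is positive and of order
   eps^(s-1) |x|^(-(k+1)(s-1)-1).  The convolution is bounded by a constant times eps^p, and since
   q > s - 1 the right-hand side, at most of order eps^(p+q) |x|^(-kq), is smaller both as |x|
   grows and as eps tends to 0. *)

theory Submission
  imports Defs
begin

text \<open>With r = |x| and T = k \<epsilon> r^(-k-1) = |Du|, the field tested against the gradient
  of \<phi> is H(r) x, where H = (T^(s-1) - g(T) T^(m-1)) / r. The weak inequality thus reduces to a
  pointwise upper bound on the divergence r H' + N H for r > 1. Since r T' = -(k+1) T, the s-part of
  -(r H' + N H) is ((k+1)(s-1) - (N-1)) T^(s-1) / r. Half of (k+1)(s-1) is reserved for absorbing
  (m-1) g(T) T^(m-1), which works for all r > 1 at once because T \<le> k \<epsilon> and g \<le>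
  g(0) there.

  The convolution is bounded uniformly in x: within distance 1 of x the kernel is integrable, as
  \<alpha> < N, and farther away it is at most 1 while u^p is integrable, as kp > N. The decay
  condition (k+1)(s-1) + 1 \<le> kq amounts to k (q - (s-1)) \<ge> s.

  Both u and H are singular at the origin. Test functions vanish near it, so products with them
  extend by zero to the whole space, where integration by parts has no boundary term.\<close>

section \<open>Compactly supported functions and the vanishing integral of their derivatives\<close>

text \<open>\<open>\<Omega>\<close> and the complement of \<open>K\<close> are open, cover the
  space, and \<open>f\<close> is continuous on each. This turns products of a test function with a
  function known only on \<open>\<Omega>\<close> into continuous functions on the whole
  space.\<close>

lemma continuous_on_UNIV_supported:
  fixes f :: "'a::topological_space \<Rightarrow> 'b::{zero,topological_space}"
  assumes "open \<Omega>" "continuous_on \<Omega> f" "closed K" "K \<subseteq> \<Omega>" "\<And>x. x \<notin> K \<Longrightarrow> f x = 0"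
  shows "continuous_on UNIV f"
proof -
  have "continuous_on (- K) f"
    using assms(5) by (subst continuous_on_cong[where g = "\<lambda>_. 0"]) auto
  then have "continuous_on (\<Omega> \<union> - K) f"
    using assms by (intro continuous_on_open_Un) auto
  moreover have "\<Omega> \<union> - K = UNIV"
    using assms(4) by auto
  ultimately show ?thesis by simp
qed

lemma integrable_lborel_supported:
  fixes f :: "'a::euclidean_space \<Rightarrow> 'b::{banach, second_countable_topology}"
  assumes "continuous_on UNIV f" "compact K" "\<And>x. x \<notin> K \<Longrightarrow> f x = 0"
  shows "integrable lborel f"
proof -
  have "integrable lborel (\<lambda>x. indicator K x *\<^sub>R f x)"
    using assms by (intro borel_integrable_compact) (auto intro: continuous_on_subset)
  also have "(\<lambda>x. indicator K x *\<^sub>R f x) = f"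
    using assms(3) by (auto simp: indicator_def)
  finally show ?thesis .
qed

lemma integrable_lebesgue_supported:
  fixes f :: "'a::euclidean_space \<Rightarrow> 'b::euclidean_space"
  assumes "continuous_on UNIV f" "compact K" "\<And>x. x \<notin> K \<Longrightarrow> f x = 0"
  shows "integrable lebesgue f"
  using integrable_lborel_supported[OF assms] assms(1)
  by (subst integrable_completion) (auto intro: borel_measurable_continuous_onI)

lemma has_derivative_zero_off_closed:
  fixes f :: "'a::real_normed_vector \<Rightarrow> 'b::real_normed_vector"
  assumes "closed K" "\<And>x. x \<notin> K \<Longrightarrow> f x = 0" "x \<notin> K"
  shows "(f has_derivative (\<lambda>_. 0)) (at x)"
  by (rule has_derivative_transform_within_open[of "\<lambda>_. 0" _ _ _ "- K"]) (use assms in auto)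

text \<open>By translation invariance the difference quotients of \<open>f\<close> have integral zero.\<close>

lemma integral_directional_derivative_eq_0:
  fixes f :: "'a::euclidean_space \<Rightarrow> real"
  assumes der: "\<And>x. (f has_derivative F x) (at x)"
    and cont: "continuous_on UNIV (\<lambda>x. F x b)"
    and K: "compact K" "\<And>x. x \<notin> K \<Longrightarrow> f x = 0"
  shows "(LINT x|lborel. F x b) = 0"
proof -
  define s where "s n x = real (Suc n) * (f (x + b /\<^sub>R real (Suc n)) - f x)" for n x
  have contf: "continuous_on UNIV f"
    using der by (meson continuous_at_imp_continuous_on has_derivative_continuous)
  have intf: "integrable lborel f"
    by (rule integrable_lborel_supported[OF contf K])
  have F0: "F x b = 0" if "x \<notin> K" for x
    using has_derivative_unique[OF der has_derivative_zero_off_closed[OF compact_imp_closed[OF K(1)] K(2) that]]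
    by simp
  have meas [measurable]: "f \<in> borel_measurable borel" "(\<lambda>x. F x b) \<in> borel_measurable borel"
    using contf cont by (auto intro: borel_measurable_continuous_onI)
  obtain B where B: "B > 0" "\<And>x. \<bar>F x b\<bar> \<le> B"
  proof -
    have "bounded ((\<lambda>x. F x b) ` K)"
      using K(1) cont by (intro compact_imp_bounded compact_continuous_image)
        (auto intro: continuous_on_subset)
    then obtain B where "B > 0" "\<forall>y\<in>(\<lambda>x. F x b) ` K. norm y \<le> B"
      unfolding bounded_pos by blast
    then show thesis
      using F0 by (intro that[of B]) (metis abs_zero imageI less_imp_le real_norm_def)+
  qed
  obtain R where R: "\<And>x. x \<in> K \<Longrightarrow> norm x \<le> R"
    using compact_imp_bounded[OF K(1)] unfolding bounded_iff by blast
  \<comment> \<open>The majorant must not depend on \<open>n\<close>. The shift b/(n+1) is no longer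
    than \<open>b\<close>, so off the ball of radius R + |b| both points of the quotient miss
    \<open>K\<close>. Inside the ball the mean value theorem turns the quotient into a directional
    derivative at an intermediate point, bounded by \<open>B\<close>.\<close>
  have sbound: "norm (s n x) \<le> B * indicator (cball 0 (R + norm b)) x" for n x
  proof (cases "x \<in> cball 0 (R + norm b)")
    case False
    have nb: "norm (b /\<^sub>R real (Suc n)) \<le> norm b"
      using mult_right_mono[of "inverse (real (Suc n))" 1 "norm b"] by (simp add: field_simps)
    have "x \<notin> K" using False R[of x] by (smt (verit) mem_cball_0 norm_ge_zero)
    moreover have "x + b /\<^sub>R real (Suc n) \<notin> K"
      using False R[of "x + b /\<^sub>R real (Suc n)"] nb norm_triangle_ineq4[of "x + b /\<^sub>R real (Suc n)" "b /\<^sub>R real (Suc n)"]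
      by auto
    ultimately show ?thesis using False K(2) by (simp add: s_def)
  next
    case True
    define h where "h = 1 / real (Suc n)"
    have h: "h > 0" by (simp add: h_def)
    have d: "((\<lambda>t. f (x + t *\<^sub>R b)) has_real_derivative F (x + t *\<^sub>R b) b) (at t)" for t
    proof -
      have "((\<lambda>t. f (x + t *\<^sub>R b)) has_derivative (\<lambda>h. F (x + t *\<^sub>R b) (h *\<^sub>R b))) (at t)"
        by (rule has_derivative_compose[OF _ der]) (auto intro!: derivative_eq_intros)
      moreover have "F (x + t *\<^sub>R b) (h *\<^sub>R b) = F (x + t *\<^sub>R b) b * h" for h
        using has_derivative_linear[OF der[of "x + t *\<^sub>R b"]] by (simp add: linear_scale)
      ultimately show ?thesis
        by (simp add: has_field_derivative_def)
    qed
    obtain z where "f (x + h *\<^sub>R b) - f (x + 0 *\<^sub>R b) = (h - 0) * F (x + z *\<^sub>R b) b"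
      using MVT2[OF h, of "\<lambda>t. f (x + t *\<^sub>R b)" "\<lambda>t. F (x + t *\<^sub>R b) b"] d by blast
    then have "s n x = F (x + z *\<^sub>R b) b"
      by (simp add: s_def h_def field_simps del: of_nat_Suc)
    then show ?thesis using B(2) True by simp
  qed
  have slim: "(\<lambda>n. s n x) \<longlonglongrightarrow> F x b" for x
  proof -
    have "((\<lambda>t. f (x + t *\<^sub>R b)) has_derivative (\<lambda>h. F x (h *\<^sub>R b))) (at 0)"
      by (rule has_derivative_compose[where f = "\<lambda>t. x + t *\<^sub>R b" and g = f]) 
         (auto intro!: derivative_eq_intros der)
    moreover have "F x (h *\<^sub>R b) = F x b * h" for h
      using has_derivative_linear[OF der[of x]] by (simp add: linear_scale)
    ultimately have "((\<lambda>t. f (x + t *\<^sub>R b)) has_real_derivative F x b) (at 0)"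
      by (simp add: has_field_derivative_def)
    then have "(\<lambda>h. (f (x + h *\<^sub>R b) - f x) / h) \<midarrow>0\<rightarrow> F x b"
      by (simp add: DERIV_def)
    moreover have "filterlim (\<lambda>n. inverse (real (Suc n))) (at 0) sequentially"
      using LIMSEQ_inverse_real_of_nat by (auto simp: filterlim_at)
    ultimately have "((\<lambda>n. (f (x + inverse (real (Suc n)) *\<^sub>R b) - f x) / inverse (real (Suc n))) \<longlongrightarrow> F x b) sequentially"
      by (rule filterlim_compose)
    then show ?thesis by (simp add: s_def field_simps del: of_nat_Suc)
  qed
  have s0: "(LINT x|lborel. s n x) = 0" for n
  proof -
    let ?c = "b /\<^sub>R real (Suc n)"
    have "integrable (distr lborel borel ((+) ?c)) f" "(LINT x|distr lborel borel ((+) ?c). f x) = (LINT x|lborel. f x)"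
      using intf by (simp_all add: lborel_distr_plus)
    then have "integrable lborel (\<lambda>x. f (?c + x))" "(LINT x|lborel. f (?c + x)) = (LINT x|lborel. f x)"
      by (simp_all add: integrable_distr_eq integral_distr)
    then show ?thesis
      using intf by (simp add: s_def add.commute)
  qed
  have "(\<lambda>n. LINT x|lborel. s n x) \<longlonglongrightarrow> (LINT x|lborel. F x b)"
  proof (rule integral_dominated_convergence)
    show "integrable lborel (\<lambda>x. B * indicator (cball 0 (R + norm b)) x :: real)"
      by (intro integrable_mult_right integrable_real_indicator emeasure_lborel_cball_finite) auto
  qed (use sbound slim in \<open>auto simp: s_def\<close>)
  then show ?thesis using s0 by (simp add: LIMSEQ_const_iff)
qed

section \<open>Test functions and integration by parts\<close>

text \<open>\<open>gradient\<close> is a definite description, so it is usable only after a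
  representing vector is shown to exist and to be unique. Among the conditions on a test function,
  C^1 regularity and compact support in \<open>\<Omega>\<close> are what the later arguments draw
  on.\<close>

lemma test_functionD:
  fixes \<phi> :: "'a::euclidean_space \<Rightarrow> real"
  assumes "test_function \<Omega> \<phi>"
  shows "continuous_on UNIV \<phi>" "(\<phi> has_derivative (\<lambda>h. gradient \<phi> x \<bullet> h)) (at x)"
    "continuous_on UNIV (gradient \<phi>)"
    "compact (closure {x. \<phi> x \<noteq> 0})" "closure {x. \<phi> x \<noteq> 0} \<subseteq> \<Omega>"
    "x \<notin> closure {x. \<phi> x \<noteq> 0} \<Longrightarrow> \<phi> x = 0" "x \<notin> closure {x. \<phi> x \<noteq> 0} \<Longrightarrow> gradient \<phi> x = 0"
proof -
  have C: "C_diff 0 \<phi>" "C_diff (Suc 0) \<phi>"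
    using assms by (auto simp: test_function_def simp del: C_diff.simps)
  then show "continuous_on UNIV \<phi>" by simp
  show *: "(\<phi> has_derivative (\<lambda>h. gradient \<phi> x \<bullet> h)) (at x)" for x
  proof -
    have d: "(\<phi> has_derivative frechet_derivative \<phi> (at x)) (at x)"
      using C(2) frechet_derivative_works by auto
    \<comment> \<open>The Riesz vector of the derivative: its coordinates are the values of the
      linear map on the basis.\<close>
    define D where "D = (\<Sum>b\<in>Basis. frechet_derivative \<phi> (at x) b *\<^sub>R b)"
    have "frechet_derivative \<phi> (at x) h = D \<bullet> h" for h
    proof -
      have "frechet_derivative \<phi> (at x) h = frechet_derivative \<phi> (at x) (\<Sum>b\<in>Basis. (h \<bullet> b) *\<^sub>R b)"
        by (simp add: euclidean_representation)
      also have "\<dots> = D \<bullet> h"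
        using has_derivative_linear[OF d]
        by (simp add: linear_sum linear_scale D_def inner_sum_left mult.commute inner_commute[of h])
      finally show ?thesis .
    qed
    then have "frechet_derivative \<phi> (at x) = (\<lambda>h. D \<bullet> h)" by blast
    then have G: "GDERIV \<phi> x :> D"
      using d by (simp add: gderiv_def inner_commute[of _ D])
    have "E = D" if "GDERIV \<phi> x :> E" for E
      using has_derivative_unique[OF that[unfolded gderiv_def] G[unfolded gderiv_def]]
      by (metis vector_eq_ldot)
    then have "gradient \<phi> x = D"
      using G unfolding gradient_def by blast
    then show ?thesis using G by (simp add: gderiv_def inner_commute)
  qed
  have "gradient \<phi> x \<bullet> v = frechet_derivative \<phi> (at x) v" for x v
    using frechet_derivative_at[OF *[of x]] by metis
  then show "continuous_on UNIV (gradient \<phi>)"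
    using C(2) by (subst continuous_on_componentwise) simp
  show "compact (closure {x. \<phi> x \<noteq> 0})" "closure {x. \<phi> x \<noteq> 0} \<subseteq> \<Omega>"
    using assms by (auto simp: test_function_def)
  show 0: "\<phi> x = 0" if "x \<notin> closure {x. \<phi> x \<noteq> 0}" for x
    using that closure_subset[of "{x. \<phi> x \<noteq> 0}"] by auto
  show "gradient \<phi> x = 0" if "x \<notin> closure {x. \<phi> x \<noteq> 0}"
  proof -
    have "(\<phi> has_derivative (\<lambda>_. 0)) (at x)"
      by (rule has_derivative_zero_off_closed[OF _ 0]) (use that in auto)
    then have "(\<lambda>h. gradient \<phi> x \<bullet> h) = (\<lambda>_. 0)"
      using * has_derivative_unique by blast
    then show ?thesis by (metis inner_eq_zero_iff)
  qed
qed

text \<open>The product of \<open>w\<close> and \<open>\<phi>\<close> has compact support, so its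
  derivative in direction \<open>b\<close> has integral 0, and the product rule splits that integral
  in two.\<close>

lemma test_function_integration_by_parts:
  fixes \<phi> w :: "'a::euclidean_space \<Rightarrow> real"
  assumes \<Omega>: "open \<Omega>" and \<phi>: "test_function \<Omega> \<phi>"
    and w: "\<And>x. x \<in> \<Omega> \<Longrightarrow> (w has_derivative W x) (at x)"
    and W: "continuous_on \<Omega> (\<lambda>x. W x b)"
  shows "integrable lebesgue (\<lambda>x. w x * (gradient \<phi> x \<bullet> b))"
    and "integrable lebesgue (\<lambda>x. \<phi> x * W x b)"
    and "(LINT x|lebesgue. w x * (gradient \<phi> x \<bullet> b)) = - (LINT x|lebesgue. \<phi> x * W x b)"
proof -
  define K where "K = closure {x. \<phi> x \<noteq> 0}"
  note \<phi> = test_functionD[OF \<phi>, folded K_def]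
  have K: "compact K" "closed K" "K \<subseteq> \<Omega>"
    using \<phi>(4,5) by (auto simp: compact_imp_closed)
  have contw: "continuous_on \<Omega> w"
    using w by (meson continuous_at_imp_continuous_on has_derivative_continuous)
  have c1: "continuous_on UNIV (\<lambda>x. w x * (gradient \<phi> x \<bullet> b))"
    by (rule continuous_on_UNIV_supported[OF \<Omega> _ K(2,3)])
       (auto intro!: continuous_intros contw continuous_on_subset[OF \<phi>(3)] simp: \<phi>(7))
  have c2: "continuous_on UNIV (\<lambda>x. \<phi> x * W x b)"
    by (rule continuous_on_UNIV_supported[OF \<Omega> _ K(2,3)])
       (auto intro!: continuous_intros W continuous_on_subset[OF \<phi>(1)] simp: \<phi>(6))
  show i1: "integrable lebesgue (\<lambda>x. w x * (gradient \<phi> x \<bullet> b))"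
    by (rule integrable_lebesgue_supported[OF c1 K(1)]) (simp add: \<phi>(7))
  show i2: "integrable lebesgue (\<lambda>x. \<phi> x * W x b)"
    by (rule integrable_lebesgue_supported[OF c2 K(1)]) (simp add: \<phi>(6))
  \<comment> \<open>Outside \<open>\<Omega>\<close> nothing is known about \<open>w\<close> and
    \<open>W\<close>, so the derivative of the product is set to 0 there. The product-rule formula
    for \<open>F x b\<close> still holds everywhere, because \<open>\<phi>\<close> and its gradient
    vanish off \<open>K\<close>.\<close>
  define F where "F x h = (if x \<in> \<Omega> then w x * (gradient \<phi> x \<bullet> h) + W x h * \<phi> x else 0)" for x h
  have F: "F x b = w x * (gradient \<phi> x \<bullet> b) + \<phi> x * W x b" for x
    using K(3) \<phi>(6,7)[of x] by (cases "x \<in> K") (auto simp: F_def)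
  have "(LINT x|lborel. F x b) = 0"
  proof (rule integral_directional_derivative_eq_0[OF _ _ K(1)])
    show "((\<lambda>x. w x * \<phi> x) has_derivative F x) (at x)" for x
    proof (cases "x \<in> \<Omega>")
      case True
      then show ?thesis
        using has_derivative_mult[OF w[OF True] \<phi>(2)[of x]] unfolding F_def by simp
    next
      case False
      then have "x \<notin> K" using K by auto
      then have "((\<lambda>x. w x * \<phi> x) has_derivative (\<lambda>_. 0)) (at x)"
        by (intro has_derivative_zero_off_closed[OF K(2)]) (auto simp: \<phi>(6))
      then show ?thesis using False unfolding F_def by simp
    qed
    show "continuous_on UNIV (\<lambda>x. F x b)"
      unfolding F using c1 c2 by (rule continuous_on_add)
  qed (simp add: \<phi>(6))
  then have "(LINT x|lebesgue. F x b) = 0"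
    using borel_measurable_continuous_onI[OF continuous_on_add[OF c1 c2]] unfolding F
    by (subst integral_completion) auto
  then show "(LINT x|lebesgue. w x * (gradient \<phi> x \<bullet> b)) = - (LINT x|lebesgue. \<phi> x * W x b)"
    unfolding F using i1 i2 by simp
qed

section \<open>Integrability of powers of the norm, and the bound on the convolution\<close>

text \<open>At scale \<open>j\<close> the function is at most c 2^(aj), and the ball of radius 2^(1
  + \<sigma> j) has volume of order 2^(\<sigma> j N). Hence \<open>f\<close> lies below a sum of
  multiples of ball indicators whose integrals form a geometric series with ratio 2^(a + \<sigma> N)
  < 1. The value \<sigma> = -1 serves a singularity at the origin, \<sigma> = 1 the decay at
  infinity.\<close>

lemma integrable_dyadic:
  fixes f :: "'a::euclidean_space \<Rightarrow> real" and a c \<sigma> :: real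
  assumes [measurable]: "f \<in> borel_measurable borel" and nonneg: "\<And>x. 0 \<le> f x"
    and c: "c \<ge> 0" and a: "a + \<sigma> * DIM('a) < 0"
    and bd: "\<And>x. f x \<noteq> 0 \<Longrightarrow> \<exists>j::nat. norm x < 2 * 2 powr (\<sigma> * j) \<and> f x \<le> c * 2 powr (a * j)"
  shows "integrable lborel f"
proof (rule integrableI_nonneg)
  let ?B = "\<lambda>j::nat. ball (0::'a) (2 * 2 powr (\<sigma> * j))"
  define q where "q = 2 powr (a + \<sigma> * DIM('a))"
  define C where "C = c * unit_ball_vol (DIM('a)) * 2 ^ DIM('a)"
  have q: "0 \<le> q" "q < 1"
    using a by (auto simp: q_def powr_less_one)
  have C: "C \<ge> 0" using c by (simp add: C_def unit_ball_vol_nonneg)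
  have le: "ennreal (f x) \<le> (\<Sum>j. ennreal (c * 2 powr (a * j)) * indicator (?B j) x)" for x
  proof (cases "f x = 0")
    case False
    then obtain j :: nat where j: "norm x < 2 * 2 powr (\<sigma> * j)" "f x \<le> c * 2 powr (a * j)"
      using bd by blast
    have "ennreal (f x) \<le> (\<Sum>j\<in>{j}. ennreal (c * 2 powr (a * j)) * indicator (?B j) x)"
      using j by (simp add: ennreal_leI)
    also have "\<dots> \<le> (\<Sum>j. ennreal (c * 2 powr (a * j)) * indicator (?B j) x)"
      by (intro sum_le_suminf) auto
    finally show ?thesis .
  qed auto
  have "(\<integral>\<^sup>+x. f x \<partial>lborel) \<le> (\<integral>\<^sup>+x. (\<Sum>j. ennreal (c * 2 powr (a * j)) * indicator (?B j) x) \<partial>lborel)"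
    by (intro nn_integral_mono le)
  also have "\<dots> = (\<Sum>j. ennreal (c * 2 powr (a * j)) * emeasure lborel (?B j))"
  proof (subst nn_integral_suminf)
    have [measurable]: "?B j \<in> sets lborel" for j by simp
    show "(\<lambda>x. ennreal (c * 2 powr (a * real j)) * indicator (?B j) x) \<in> borel_measurable lborel" for j
      by measurable
  qed (simp only: nn_integral_cmult_indicator sets_lborel borel_open open_ball)
  also have "\<dots> = (\<Sum>j. ennreal (C * q ^ j))"
  proof (rule suminf_cong)
    fix j :: nat
    have "(2 powr (\<sigma> * j)) ^ DIM('a) = 2 powr (\<sigma> * j * DIM('a))"
      by (simp add: powr_realpow[symmetric] powr_powr)
    moreover have "q ^ j = 2 powr (a * j) * 2 powr (\<sigma> * j * DIM('a))"
      by (simp add: q_def powr_realpow[symmetric] powr_powr powr_add[symmetric] algebra_simps)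
    ultimately have "c * 2 powr (a * j) * (unit_ball_vol (DIM('a)) * (2 * 2 powr (\<sigma> * j)) ^ DIM('a)) = C * q ^ j"
      by (simp add: C_def power_mult_distrib)
    then show "ennreal (c * 2 powr (a * j)) * emeasure lborel (?B j) = ennreal (C * q ^ j)"
      using c by (subst emeasure_ball) (auto simp: ennreal_mult[symmetric] unit_ball_vol_nonneg)
  qed
  also have "\<dots> < \<infinity>"
    using q C by (subst suminf_ennreal2) (auto intro!: summable_mult summable_geometric)
  finally show "(\<integral>\<^sup>+x. f x \<partial>lborel) < \<infinity>" .
qed (use nonneg in auto)

lemma integrable_norm_powr_ball:
  fixes a :: real
  assumes "0 < a" "a < DIM('a::euclidean_space)"
  shows "integrable lborel (\<lambda>y::'a. indicator (ball 0 1) y * norm y powr (- a))"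
proof (rule integrable_dyadic[where \<sigma> = "-1" and a = a and c = "2 powr a"])
  fix x :: 'a
  assume "indicator (ball 0 1) x * norm x powr (- a) \<noteq> (0::real)"
  \<comment> \<open>The origin is excluded because \<open>0 powr (- a)\<close> is 0.\<close>
  then have x: "norm x > 0" "norm x < 1" by (auto split: split_indicator_asm)
  \<comment> \<open>This is the shell 2^(-j-1) < |x| \<le> 2^(-j). Its inner radius gives |x|^(-a) <
    2^(a(j+1)), which accounts for the constant 2^a.\<close>
  define j where "j = nat \<lfloor>- log 2 (norm x)\<rfloor>"
  have j: "real j \<le> - log 2 (norm x)" "- log 2 (norm x) < real j + 1"
    using x by (auto simp: j_def)
  have "2 powr log 2 (norm x) < 2 * 2 powr (- real j)" 
    using j(1) by (subst powr_mult_base) auto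
  moreover have "(2 powr log 2 (norm x)) powr (- a) \<le> 2 powr a * 2 powr (a * j)"
    using j(2) assms(1) mult_left_mono[of "- log 2 (norm x)" "real j + 1" a]
    by (auto simp: powr_powr powr_add[symmetric] algebra_simps)
  ultimately show "\<exists>j::nat. norm x < 2 * 2 powr (- 1 * j) \<and>
      indicator (ball 0 1) x * norm x powr (- a) \<le> 2 powr a * 2 powr (a * j)"
    using x by (intro exI[of _ j]) auto
next
  show "(\<lambda>y::'a. indicator (ball 0 1) y * norm y powr (- a)) \<in> borel_measurable borel"
    by (intro borel_measurable_times borel_measurable_indicator powr_real_measurable
        borel_measurable_const borel_measurable_norm measurable_ident_sets borel_closed borel_open) auto
qed (use assms in auto)

lemma integrable_norm_powr_outside_ball:
  fixes b :: real
  assumes "b > DIM('a::euclidean_space)"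
  shows "integrable lborel (\<lambda>y::'a. indicator (- ball 0 1) y * norm y powr (- b))"
proof (rule integrable_dyadic[where \<sigma> = 1 and a = "- b" and c = 1])
  fix x :: 'a
  assume "indicator (- ball 0 1) x * norm x powr (- b) \<noteq> (0::real)"
  then have x: "norm x \<ge> 1" by (auto split: split_indicator_asm)
  define j where "j = nat \<lfloor>log 2 (norm x)\<rfloor>"
  have j: "real j \<le> log 2 (norm x)" "log 2 (norm x) < real j + 1"
    using zero_le_log_cancel_iff[of 2 "norm x"] x unfolding j_def by linarith+
  have lx: "2 powr log 2 (norm x) = norm x" using x by (intro powr_log_cancel) auto
  have "2 powr log 2 (norm x) < 2 * 2 powr (real j)" 
    using j(2) by (subst powr_mult_base) auto
  moreover have "(2 powr log 2 (norm x)) powr (- b) \<le> 2 powr (- b * j)"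
    using j(1) assms mult_left_mono[of "real j" "log 2 (norm x)" b]
    by (auto simp: powr_powr algebra_simps)
  ultimately show "\<exists>j::nat. norm x < 2 * 2 powr (1 * j) \<and>
      indicator (- ball 0 1) x * norm x powr (- b) \<le> 1 * 2 powr (- b * j)"
    using lx by (intro exI[of _ j]) (auto split: split_indicator)
next
  show "(\<lambda>y::'a. indicator (- ball 0 1) y * norm y powr (- b)) \<in> borel_measurable borel"
    by (intro borel_measurable_times borel_measurable_indicator powr_real_measurable
        borel_measurable_const borel_measurable_norm measurable_ident_sets borel_closed borel_open) auto
qed (use assms in auto)

text \<open>For |y| \<ge> 1 the integrand, freed of its factor \<epsilon>^p, is at most
  \<open>f (x - y) + h y\<close>: if |x - y| < 1, then |y|^(-kp) \<le> 1 and only the kernel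
  remains; otherwise the kernel is at most 1. By translation and reflection the integral of
  \<open>f (x - y)\<close> does not depend on \<open>x\<close>.\<close>

lemma ext_conv_power_bounded:
  fixes \<alpha> k p :: real
  assumes "0 < \<alpha>" "\<alpha> < DIM('a::euclidean_space)" "k * p > DIM('a)" "p > 0"
  obtains C where "C \<ge> 0"
    "\<And>\<epsilon> (x::'a). \<epsilon> \<ge> 0 \<Longrightarrow> ext_conv \<alpha> p (\<lambda>x. \<epsilon> * norm x powr (- k)) x \<le> C * \<epsilon> powr p"
proof -
  define f where "f y = indicator (ball 0 1) y * norm y powr (- \<alpha>)" for y :: 'a
  define h where "h y = indicator (- ball 0 1) y * norm y powr (- (k * p))" for y :: 'a
  have f [measurable]: "integrable lborel f" and h: "integrable lborel h"
    unfolding f_def h_def using assms by (auto intro!: integrable_norm_powr_ball integrable_norm_powr_outside_ball)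
  have fh0: "f y \<ge> 0" "h y \<ge> 0" for y by (auto simp: f_def h_def)
  define C where "C = (LINT y|lborel. f y) + (LINT y|lborel. h y)"
  have f': "integrable lborel (\<lambda>y. f (x - y))" "(LINT y|lborel. f (x - y)) = (LINT y|lborel. f y)" for x
  proof -
    have "f (x - y) = f (- x + y)" for y
      by (simp add: f_def indicator_def norm_minus_commute)
    moreover have "integrable (distr lborel borel ((+) (- x))) f"
       "(LINT y|distr lborel borel ((+) (- x)). f y) = (LINT y|lborel. f y)"
      using f by (simp_all add: lborel_distr_plus)
    then have "integrable lborel (\<lambda>y. f (- x + y))" "(LINT y|lborel. f (- x + y)) = (LINT y|lborel. f y)"
      using f by (simp_all add: integrable_distr_eq integral_distr)
    ultimately show "integrable lborel (\<lambda>y. f (x - y))" "(LINT y|lborel. f (x - y)) = (LINT y|lborel. f y)"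
      by simp_all
  qed
  show thesis
  proof (rule that)
    show "C \<ge> 0" unfolding C_def using fh0 by (intro add_nonneg_nonneg integral_nonneg) auto
    fix \<epsilon> :: real and x :: 'a
    assume \<epsilon>: "\<epsilon> \<ge> 0"
    have int: "integrable lborel (\<lambda>y. \<epsilon> powr p * (f (x - y) + h y))"
      using f' h by auto
    have "ext_conv \<alpha> p (\<lambda>x. \<epsilon> * norm x powr (- k)) x \<le> (LINT y|lebesgue. \<epsilon> powr p * (f (x - y) + h y))"
      unfolding ext_conv_def set_lebesgue_integral_def
    \<comment> \<open>Only the majorant has to be integrable here: it is nonnegative, and a
      non-integrable integrand would have integral 0 by convention.\<close>
    proof (rule integral_mono')
      show "integrable lebesgue (\<lambda>y. \<epsilon> powr p * (f (x - y) + h y))"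
        using int by (rule integrable_completion[OF borel_measurable_integrable[OF int], THEN iffD2])
      fix y :: 'a
      have "norm y powr (- (k * p)) / norm (x - y) powr \<alpha> \<le> f (x - y) + h y" if y: "norm y \<ge> 1"
      proof (cases "norm (x - y) < 1")
        case True
        have "norm y powr (- (k * p)) \<le> norm y powr 0"
          using y assms by (intro powr_mono) (auto intro: less_imp_le order.strict_trans1[of 0 "real DIM('a)"])
        then have "norm y powr (- (k * p)) \<le> 1" using y by (auto split: if_splits)
        \<comment> \<open>At y = x both sides are 0, by the conventions for \<open>powr\<close> with
          base 0 and for division by 0.\<close>
        then have "norm y powr (- (k * p)) / norm (x - y) powr \<alpha> \<le> f (x - y)"
          using True divide_right_mono[of "norm y powr (- (k * p))" 1 "norm (x - y) powr \<alpha>"]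
          by (simp add: f_def powr_minus_divide)
        then show ?thesis using fh0[of y] by simp
      next
        case False
        then have "norm (x - y) powr \<alpha> \<ge> 1" using assms by (simp add: ge_one_powr_ge_zero)
        then have "norm y powr (- (k * p)) / norm (x - y) powr \<alpha> \<le> norm y powr (- (k * p)) / 1"
          by (intro divide_left_mono) auto
        then show ?thesis using fh0(1)[of "x - y"] y by (simp add: h_def)
      qed
      then have "\<epsilon> powr p * (norm y powr (- (k * p)) / norm (x - y) powr \<alpha>) \<le> \<epsilon> powr p * (f (x - y) + h y)"
        if "norm y \<ge> 1"
        using that by (intro mult_left_mono) auto
      then show "indicat_real (- ball 0 1) y *\<^sub>R ((\<epsilon> * norm y powr - k) powr p / norm (x - y) powr \<alpha>)
          \<le> \<epsilon> powr p * (f (x - y) + h y)"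
        using fh0 \<epsilon> by (auto simp: powr_mult powr_powr split: split_indicator)
    qed (use fh0 in auto)
    also have "\<dots> = (LINT y|lborel. \<epsilon> powr p * (f (x - y) + h y))"
      by (rule integral_completion[OF borel_measurable_integrable[OF int]])
    also have "\<dots> = C * \<epsilon> powr p"
      by (simp add: C_def f' h)
    finally show "ext_conv \<alpha> p (\<lambda>x. \<epsilon> * norm x powr (- k)) x \<le> C * \<epsilon> powr p" .
  qed
qed

section \<open>Radial fields, and C^1 functions as Sobolev functions\<close>

lemma has_derivative_radial:
  fixes x :: "'a::euclidean_space"
  assumes "(\<rho> has_real_derivative d) (at (norm x))" "x \<noteq> 0"
  shows "((\<lambda>x. \<rho> (norm x)) has_derivative (\<lambda>h. d / norm x * (x \<bullet> h))) (at x)"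
proof -
  have "((\<lambda>x. \<rho> (norm x)) has_derivative (\<lambda>h. d * (h \<bullet> sgn x))) (at x)"
    using has_derivative_compose[OF has_derivative_norm[OF assms(2)], of \<rho> "\<lambda>h. d * h"] assms(1)
    by (simp add: has_field_derivative_def)
  then show ?thesis
    by (simp add: sgn_div_norm inner_commute field_simps)
qed

lemma continuous_on_radial:
  fixes \<Omega> :: "'a::euclidean_space set"
  assumes "continuous_on {0<..} f" "0 \<notin> \<Omega>"
  shows "continuous_on \<Omega> (\<lambda>x. f (norm x))"
  by (rule continuous_on_compose2[OF assms(1)]) (use assms(2) in \<open>auto intro!: continuous_intros\<close>)

text \<open>The factor r H'(r) + N H(r) is the divergence of the field H(|x|) x. Each component
  H(|x|) (x \<bullet> b) is integrated by parts in its own direction \<open>b\<close>, with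
  derivative \<open>W b x\<close>, and the results are summed over the basis.\<close>

lemma radial_field_divergence:
  fixes H H' :: "real \<Rightarrow> real"
    and \<phi> :: "'a::euclidean_space \<Rightarrow> real"
  assumes \<Omega>: "open \<Omega>" "0 \<notin> \<Omega>" and \<phi>: "test_function \<Omega> \<phi>"
    and H: "\<And>r. r > 0 \<Longrightarrow> (H has_real_derivative H' r) (at r)"
    and H': "continuous_on {0<..} H'"
  shows "integrable lebesgue (\<lambda>x. \<phi> x * (norm x * H' (norm x) + DIM('a) * H (norm x)))"
    and "(LINT x|lebesgue. H (norm x) * (x \<bullet> gradient \<phi> x)) =
      - (LINT x|lebesgue. \<phi> x * (norm x * H' (norm x) + DIM('a) * H (norm x)))"
proof -
  define W where "W b x h = H' (norm x) / norm x * (x \<bullet> h) * (x \<bullet> b) + H (norm x) * (h \<bullet> b)"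
    for b x h :: 'a
  have contH: "continuous_on {0<..} H"
    using H by (auto intro!: continuous_at_imp_continuous_on DERIV_isCont)
  have w: "((\<lambda>x. H (norm x) * (x \<bullet> b)) has_derivative W b x) (at x)" if "x \<in> \<Omega>" for b x
  proof -
    have x: "x \<noteq> 0" using that \<Omega> by auto
    show ?thesis
      unfolding W_def
      by (rule derivative_eq_intros has_derivative_radial[OF H] refl x | use x in force)+
  qed
  have W: "continuous_on \<Omega> (\<lambda>x. W b x b)" for b
    unfolding W_def using \<Omega>(2)
    by (intro continuous_intros continuous_on_radial[OF contH] continuous_on_radial[OF H']) auto
  have divW: "(\<Sum>b\<in>Basis. \<phi> x * W b x b) = \<phi> x * (norm x * H' (norm x) + DIM('a) * H (norm x))" for x
  proof -
    have "(\<Sum>b\<in>Basis. W b x b) = H' (norm x) / norm x * (\<Sum>b\<in>Basis. (x \<bullet> b) * (x \<bullet> b)) + DIM('a) * H (norm x)"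
      unfolding W_def by (simp add: sum.distrib sum_distrib_left mult.assoc)
    also have "(\<Sum>b\<in>Basis. (x \<bullet> b) * (x \<bullet> b)) = norm x * norm x"
      by (simp add: euclidean_inner[symmetric] dot_square_norm power2_eq_square)
    finally show ?thesis by (simp add: sum_distrib_left[symmetric])
  qed
  note ibp = test_function_integration_by_parts[OF \<Omega>(1) \<phi> w W]
  show "integrable lebesgue (\<lambda>x. \<phi> x * (norm x * H' (norm x) + DIM('a) * H (norm x)))"
    unfolding divW[symmetric] using ibp(2) by auto
  have "(LINT x|lebesgue. H (norm x) * (x \<bullet> gradient \<phi> x)) =
      (LINT x|lebesgue. (\<Sum>b\<in>Basis. H (norm x) * (x \<bullet> b) * (gradient \<phi> x \<bullet> b)))"
    by (subst euclidean_inner) (simp add: sum_distrib_left mult.assoc)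
  also have "\<dots> = (\<Sum>b\<in>Basis. - (LINT x|lebesgue. \<phi> x * W b x b))"
    using ibp(1,3) by (subst Bochner_Integration.integral_sum) auto
  also have "\<dots> = - (LINT x|lebesgue. (\<Sum>b\<in>Basis. \<phi> x * W b x b))"
    using ibp(2) by (subst Bochner_Integration.integral_sum) (auto simp: sum_negf)
  finally show "(LINT x|lebesgue. H (norm x) * (x \<bullet> gradient \<phi> x)) =
      - (LINT x|lebesgue. \<phi> x * (norm x * H' (norm x) + DIM('a) * H (norm x)))"
    unfolding divW .
qed

lemma L_loc_continuous:
  fixes f :: "'a::euclidean_space \<Rightarrow> 'b::euclidean_space"
  assumes "open \<Omega>" "continuous_on \<Omega> f" "r > 0"
  shows "L_loc r \<Omega> f"
  unfolding L_loc_def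
proof (intro conjI allI impI)
  have "(\<lambda>x. indicator \<Omega> x *\<^sub>R f x) \<in> borel_measurable borel"
    using assms by (intro borel_measurable_continuous_on_indicator) auto
  then show "set_borel_measurable lebesgue \<Omega> f"
    unfolding set_borel_measurable_def by (intro measurable_completion) simp
  fix K assume K: "compact K \<and> K \<subseteq> \<Omega>"
  have "continuous_on K (\<lambda>x. norm (f x) powr r)"
    using K assms by (intro continuous_on_powr' continuous_intros) (auto intro: continuous_on_subset)
  then have "integrable lborel (\<lambda>x. indicator K x *\<^sub>R (norm (f x) powr r))"
    using K by (intro borel_integrable_compact) auto
  then show "set_integrable lebesgue K (\<lambda>x. norm (f x) powr r)"
    unfolding set_integrable_def by (subst integrable_completion) auto
qed

text \<open>Integrals over the complements of the closed and of the open unit ball both become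
  integrals over the whole space, since a factor \<open>\<phi>\<close> or
  \<open>gradient \<phi>\<close> vanishes elsewhere.\<close>

lemma set_integral_supported:
  fixes f :: "'a::euclidean_space \<Rightarrow> 'b::euclidean_space"
  assumes "\<And>x. x \<notin> A \<Longrightarrow> f x = 0"
  shows "(LINT x:A|M. f x) = (LINT x|M. f x)"
  unfolding set_lebesgue_integral_def
  by (rule Bochner_Integration.integral_cong) (use assms in \<open>auto simp: indicator_def\<close>)

text \<open>Paired with a basis vector, the vector identity becomes scalar integration by parts with
  \<open>w = u\<close>.\<close>

lemma weak_gradient_C1:
  fixes u :: "'a::euclidean_space \<Rightarrow> real"
  assumes \<Omega>: "open \<Omega>" and u: "\<And>x. x \<in> \<Omega> \<Longrightarrow> (u has_derivative (\<lambda>h. Du x \<bullet> h)) (at x)"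
    and Du: "continuous_on \<Omega> Du"
  shows "weak_gradient \<Omega> u Du"
  unfolding weak_gradient_def
proof (intro allI impI)
  fix \<phi> assume test: "test_function \<Omega> \<phi>"
  define K where "K = closure {x. \<phi> x \<noteq> 0}"
  note \<phi> = test_functionD[OF test, folded K_def]
  have contu: "continuous_on \<Omega> u"
    using u by (meson continuous_at_imp_continuous_on has_derivative_continuous)
  have K: "closed K" using \<phi>(4) by (rule compact_imp_closed)
  have c1: "continuous_on UNIV (\<lambda>x. u x *\<^sub>R gradient \<phi> x)"
    by (rule continuous_on_UNIV_supported[OF \<Omega> _ K \<phi>(5)])
      (auto intro!: continuous_intros contu continuous_on_subset[OF \<phi>(3)] simp: \<phi>(7))
  have c2: "continuous_on UNIV (\<lambda>x. \<phi> x *\<^sub>R Du x)"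
    by (rule continuous_on_UNIV_supported[OF \<Omega> _ K \<phi>(5)])
      (auto intro!: continuous_intros Du continuous_on_subset[OF \<phi>(1)] simp: \<phi>(6))
  have i1: "integrable lebesgue (\<lambda>x. u x *\<^sub>R gradient \<phi> x)"
    by (rule integrable_lebesgue_supported[OF c1 \<phi>(4)]) (simp add: \<phi>(7))
  have i2: "integrable lebesgue (\<lambda>x. \<phi> x *\<^sub>R Du x)"
    by (rule integrable_lebesgue_supported[OF c2 \<phi>(4)]) (simp add: \<phi>(6))
  have "(LINT x|lebesgue. u x *\<^sub>R gradient \<phi> x) = - (LINT x|lebesgue. \<phi> x *\<^sub>R Du x)"
  proof (rule euclidean_eqI)
    fix b :: 'a assume b: "b \<in> Basis"
    have "(LINT x|lebesgue. u x *\<^sub>R gradient \<phi> x) \<bullet> b = (LINT x|lebesgue. u x * (gradient \<phi> x \<bullet> b))"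
      using i1 by (subst integral_inner_left[symmetric]) auto
    also have "\<dots> = - (LINT x|lebesgue. \<phi> x * (Du x \<bullet> b))"
      by (rule test_function_integration_by_parts(3)[OF \<Omega> test u]) (auto intro!: continuous_intros Du)
    also have "\<dots> = (- (LINT x|lebesgue. \<phi> x *\<^sub>R Du x)) \<bullet> b"
      unfolding inner_minus_left using i2 by (subst integral_inner_left[symmetric]) auto
    finally show "(LINT x|lebesgue. u x *\<^sub>R gradient \<phi> x) \<bullet> b = (- (LINT x|lebesgue. \<phi> x *\<^sub>R Du x)) \<bullet> b" .
  qed
  moreover have "u x *\<^sub>R gradient \<phi> x = 0" "\<phi> x *\<^sub>R Du x = 0" if "x \<notin> \<Omega>" for x
    using that \<phi>(5) \<phi>(6,7)[of x] by auto
  ultimately show "(LINT x:\<Omega>|lebesgue. u x *\<^sub>R gradient \<phi> x) = - (LINT x:\<Omega>|lebesgue. \<phi> x *\<^sub>R Du x)"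
    by (simp add: set_integral_supported)
qed

section \<open>Sign of the divergence, choice of parameters, and the derivative of the radial
  flux\<close>

lemma antimono_on_imp_deriv_nonpos:
  fixes f :: "real \<Rightarrow> real"
  assumes "antimono_on {a..} f" "a < t" "(f has_real_derivative d) (at t)"
  shows "d \<le> 0"
proof (rule ccontr)
  assume "\<not> d \<le> 0"
  then obtain \<delta> where \<delta>: "\<delta> > 0" "\<forall>h>0. h < \<delta> \<longrightarrow> f t < f (t + h)"
    using DERIV_pos_inc_right[OF assms(3)] by auto
  then have "f t < f (t + \<delta> / 2)" by simp
  moreover have "f (t + \<delta> / 2) \<le> f t"
    using monotone_onD[OF assms(1), of t "t + \<delta> / 2"] assms(2) \<delta>(1) by auto
  ultimately show False by simp
qed

text \<open>The left-hand side is -r times the divergence of the flux, with t = |Du| and d = g'(t).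
  Write X = t^(s-1). The smallness assumption makes (m-1) g t^(m-1) at most half of (s-1) X, and the
  term with \<open>d\<close> helps. So the first part is at least (k+1)(s-1)/2 X \<ge> n X, and the
  second removes at most (n-1) X.\<close>

lemma s_term_dominates:
  fixes t s m k n d :: real
  assumes t: "t > 0" and g: "0 < g" "g \<le> G" and d: "d \<le> 0" and s: "1 < s" "s < m"
    and small: "(m - 1) * G * t powr (m - s) \<le> (s - 1) / 2"
    and k: "(k + 1) * (s - 1) / 2 \<ge> n" "k > 0" and n: "n \<ge> 1"
  shows "(k + 1) * ((s - 1) * t powr (s - 1) - d * t powr m - (m - 1) * g * t powr (m - 1))
    - (n - 1) * (t powr (s - 1) - g * t powr (m - 1)) \<ge> t powr (s - 1)"
proof -
  define X where "X = t powr (s - 1)"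
  have X: "X > 0" using t by (simp add: X_def)
  have "t powr (m - 1) = t powr (m - s) * X"
    by (simp add: X_def powr_add[symmetric])
  then have "(m - 1) * g * t powr (m - 1) = ((m - 1) * g * t powr (m - s)) * X" by simp
  also have "\<dots> \<le> ((m - 1) * G * t powr (m - s)) * X"
    using g s X by (intro mult_right_mono mult_left_mono) auto
  also have "\<dots> \<le> (s - 1) / 2 * X"
    using X small by (intro mult_right_mono) auto
  finally have "(m - 1) * g * t powr (m - 1) \<le> (s - 1) / 2 * X" .
  moreover have "d * t powr m \<le> 0" using d by (simp add: mult_nonpos_nonneg)
  moreover have "(s - 1) * X = (s - 1) / 2 * X + (s - 1) / 2 * X" by simp
  ultimately have "(s - 1) / 2 * X \<le> (s - 1) * X - d * t powr m - (m - 1) * g * t powr (m - 1)"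
    by linarith
  then have "(k + 1) * ((s - 1) / 2 * X) \<le> (k + 1) * ((s - 1) * X - d * t powr m - (m - 1) * g * t powr (m - 1))"
    using k by (intro mult_left_mono) auto
  moreover have "n * X \<le> (k + 1) * (s - 1) / 2 * X"
    using k X by (intro mult_right_mono) auto
  moreover have "(n - 1) * (X - g * t powr (m - 1)) \<le> (n - 1) * X"
    using n g by (intro mult_left_mono) auto
  moreover have "(k + 1) * ((s - 1) / 2 * X) = (k + 1) * (s - 1) / 2 * X" "n * X = (n - 1) * X + X"
    by (simp_all add: algebra_simps)
  ultimately show ?thesis unfolding X_def[symmetric] by linarith
qed

text \<open>The constant \<open>C\<close> of the convolution bound depends on \<open>k\<close>, so
  \<epsilon> is provided for every \<open>C\<close> once \<open>k\<close> is fixed. It exists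
  because m - s and p + q - (s-1) are positive, so that both powers of \<epsilon> tend to 0.\<close>

lemma exists_parameters:
  fixes N p q s m G :: real
  assumes "N \<ge> 1" "p > 0" "1 < s" "s < m" "q > s - 1"
  obtains k where "k \<ge> 1" "k * p > N" "(k + 1) * (s - 1) + 1 \<le> k * q" "(k + 1) * (s - 1) / 2 \<ge> N"
    and "\<And>C. \<exists>\<epsilon>>0. (m - 1) * G * (k * \<epsilon>) powr (m - s) \<le> (s - 1) / 2 \<and> C * \<epsilon> powr (p + q - (s - 1)) \<le> 1"
proof -
  \<comment> \<open>One summand per requirement: N/p for kp > N, s/(q - (s-1)) for the decay
    condition in the form k (q - (s-1)) \<ge> s, and 2N/(s-1) for the margin over the
    dimension.\<close>
  define k where "k = 1 + N / p + s / (q - (s - 1)) + 2 * N / (s - 1)"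
  have pos: "N / p > 0" "s / (q - (s - 1)) > 0" "2 * N / (s - 1) > 0"
    using assms by auto
  have k1: "k \<ge> 1" using pos by (simp add: k_def)
  have "N / p < k" "s / (q - (s - 1)) \<le> k" "2 * N / (s - 1) \<le> k + 1"
    using pos by (auto simp: k_def)
  then have k: "k * p > N" "k * (q - (s - 1)) \<ge> s" "(k + 1) * (s - 1) \<ge> 2 * N"
    using assms by (simp_all add: divide_less_eq divide_le_eq mult.commute)
  have "\<exists>\<epsilon>>0. (m - 1) * G * (k * \<epsilon>) powr (m - s) \<le> (s - 1) / 2 \<and> C * \<epsilon> powr (p + q - (s - 1)) \<le> 1" for C
  proof -
    have pos: "eventually (\<lambda>\<epsilon>::real. \<epsilon> > 0) (at_right 0)"
      by (simp add: eventually_at_right_less)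
    have "((\<lambda>\<epsilon>. (k * \<epsilon>) powr (m - s)) \<longlongrightarrow> 0) (at_right 0)"
      using assms k1
      by (intro tendsto_zero_powrI[where b = "m - s"] tendsto_const eventually_mono[OF pos])
         (auto intro!: tendsto_eq_intros)
    from tendsto_mult_left[OF this, of "(m - 1) * G"]
    have 1: "((\<lambda>\<epsilon>. (m - 1) * G * (k * \<epsilon>) powr (m - s)) \<longlongrightarrow> 0) (at_right 0)" by simp
    have "((\<lambda>\<epsilon>. \<epsilon> powr (p + q - (s - 1))) \<longlongrightarrow> 0) (at_right 0)"
      using assms
      by (intro tendsto_zero_powrI[where b = "p + q - (s - 1)"] tendsto_const eventually_mono[OF pos])
         (auto intro!: tendsto_eq_intros)
    from tendsto_mult_left[OF this, of C]
    have 2: "((\<lambda>\<epsilon>. C * \<epsilon> powr (p + q - (s - 1))) \<longlongrightarrow> 0) (at_right 0)" by simp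
    have "eventually (\<lambda>\<epsilon>. \<epsilon> > 0 \<and> (m - 1) * G * (k * \<epsilon>) powr (m - s) < (s - 1) / 2 \<and>
        C * \<epsilon> powr (p + q - (s - 1)) < 1) (at_right 0)"
      using pos order_tendstoD(2)[OF 1, of "(s - 1) / 2"] order_tendstoD(2)[OF 2, of 1] assms
      by (auto elim!: eventually_elim2 intro!: eventually_conj)
    then show ?thesis
      using eventually_happens by (fastforce simp: trivial_limit_at_right_real)
  qed
  then show thesis
    using that[of k] k1 k by (simp add: algebra_simps)
qed

text \<open>Because T' = -(k+1) T / r, the chain rule multiplies each differentiated power of
  \<open>T\<close> by \<open>T\<close> again. The result is an expression in \<open>T r\<close> and
  \<open>r\<close> alone, with \<open>D\<close> in the role of g'. Positivity of \<open>T\<close> on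
  r > 0 keeps the argument of \<open>g\<close> inside the region where it is differentiable.\<close>

lemma power_solution_flux:
  fixes g D :: "real \<Rightarrow> real" and k \<epsilon> m s :: real
  defines "T \<equiv> \<lambda>r. k * \<epsilon> * r powr (- k - 1)"
  defines "H \<equiv> \<lambda>r. (T r powr (s - 1) - g (T r) * T r powr (m - 1)) / r"
  defines "H' \<equiv> \<lambda>r. (- (k + 1) * ((s - 1) * T r powr (s - 1) - D (T r) * T r powr m
      - (m - 1) * g (T r) * T r powr (m - 1)) - (T r powr (s - 1) - g (T r) * T r powr (m - 1))) / r\<^sup>2"
  assumes k: "k > 0" and \<epsilon>: "\<epsilon> > 0"
    and g: "\<And>t. t > 0 \<Longrightarrow> (g has_real_derivative D t) (at t)" and D: "continuous_on {0<..} D"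
  shows "r > 0 \<Longrightarrow> (H has_real_derivative H' r) (at r)" and "continuous_on {0<..} H'"
proof -
  have T: "T r > 0" if "r > 0" for r using that k \<epsilon> by (simp add: T_def)
  show "(H has_real_derivative H' r) (at r)" if r: "r > 0"
  proof -
    define t where "t = T r"
    have t: "t > 0" using T[OF r] by (simp add: t_def)
    have dT: "(T has_real_derivative - (k + 1) * t / r) (at r)"
    proof -
      have "(T has_real_derivative k * \<epsilon> * ((- k - 1) * r powr (- k - 1 - 1))) (at r)"
        unfolding T_def using r by (auto intro!: derivative_eq_intros)
      moreover have "k * \<epsilon> * ((- k - 1) * r powr (- k - 1 - 1)) = - (k + 1) * t / r"
        unfolding t_def T_def powr_diff[of r "- k - 1" 1] using r by (simp add: field_simps)
      ultimately show ?thesis by simp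
    qed
    have "((\<lambda>t. t powr (s - 1) - g t * t powr (m - 1)) has_real_derivative
        (s - 1) * t powr (s - 1 - 1) - (D t * t powr (m - 1) + g t * ((m - 1) * t powr (m - 1 - 1)))) (at t)"
      using t by (auto intro!: derivative_eq_intros g)
    from DERIV_chain2[OF this[unfolded t_def] dT[unfolded t_def], folded t_def]
    have "((\<lambda>r. T r powr (s - 1) - g (T r) * T r powr (m - 1)) has_real_derivative
        ((s - 1) * t powr (s - 1 - 1) - (D t * t powr (m - 1) + g t * ((m - 1) * t powr (m - 1 - 1))))
          * (- (k + 1) * t / r)) (at r)" .
    moreover have "((s - 1) * t powr (s - 1 - 1) - (D t * t powr (m - 1) + g t * ((m - 1) * t powr (m - 1 - 1))))
          * (- (k + 1) * t / r) = - (k + 1) * ((s - 1) * t powr (s - 1) - D t * t powr m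
      - (m - 1) * g t * t powr (m - 1)) / r" (is "?a = ?b / r")
    proof -
      \<comment> \<open>The factor \<open>t\<close> from T' raises the exponents s-2, m-1 and m-2 by
        one.\<close>
      have e: "t powr m = t powr (m - 1) * t" using t powr_add[of t "m - 1" 1] by simp
      show ?thesis
        unfolding e powr_diff[of t "s - 1" 1] powr_diff[of t "m - 1" 1] using t r by (simp add: field_simps)
    qed
    ultimately have "((\<lambda>r. T r powr (s - 1) - g (T r) * T r powr (m - 1)) has_real_derivative ?b / r) (at r)"
      by (simp only:)
    from DERIV_divide[OF this DERIV_ident] r
    have "(H has_real_derivative (?b / r * r - (t powr (s - 1) - g t * t powr (m - 1)) * 1) / (r * r)) (at r)"
      by (simp add: H_def t_def)
    then show ?thesis using r by (simp add: H'_def t_def power2_eq_square)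
  qed
  have "continuous_on {0<..} T" unfolding T_def by (auto intro!: continuous_intros)
  moreover have "continuous_on {0<..} g"
    using g by (auto intro!: continuous_at_imp_continuous_on DERIV_isCont)
  ultimately have [continuous_intros]: "continuous_on {0<..} T" "continuous_on {0<..} (\<lambda>r. g (T r))"
    "continuous_on {0<..} (\<lambda>r. D (T r))"
    using T by (auto intro!: continuous_on_compose2[OF D] continuous_on_compose2[of "{0<..}" g])
  show "continuous_on {0<..} H'"
    unfolding H'_def using T by (intro continuous_intros) (auto simp: less_imp_neq[symmetric] dest: T)
qed

section \<open>Verification that \<epsilon> |x|^(-k) satisfies the differential inequality\<close>

theorem theorem1p1:
  fixes \<alpha> p q m s :: real and g :: "real \<Rightarrow> real"
  assumes "0 < \<alpha>" and "\<alpha> < real CARD('n::finite)"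
    and "p > 0"
    and "\<And>t. t \<ge> 0 \<Longrightarrow> g t > 0"
    and "antimono_on {0..} g"
    and "continuous_on {0..} g"
    and "g C1_differentiable_on {0<..}"
    and "((\<lambda>t. t * deriv g t / g t) \<longlongrightarrow> 0) (at_right 0)"
    and "1 < s" and "s < m"
    and "q > s - 1"
  shows "\<exists>u :: real ^ 'n \<Rightarrow> real. positive_solution \<alpha> p q m s g u"
proof -
  define n where "n = real DIM(real ^ 'n)"
  have n: "n \<ge> 1" "\<alpha> < n" using assms(2) by (simp_all add: n_def Suc_le_eq)
  obtain D where D: "\<And>t. t > 0 \<Longrightarrow> (g has_real_derivative D t) (at t)" "continuous_on {0<..} D"
    using assms(7) unfolding C1_differentiable_on_def
    by (auto simp: has_real_derivative_iff_has_vector_derivative)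
  \<comment> \<open>As \<open>g\<close> is non-increasing, \<open>g 0\<close> is an upper bound for
    it and serves as \<open>G\<close>.\<close>
  obtain k where k: "k \<ge> 1" "k * p > n" "(k + 1) * (s - 1) + 1 \<le> k * q" "(k + 1) * (s - 1) / 2 \<ge> n"
    and ex: "\<And>C. \<exists>\<epsilon>>0. (m - 1) * g 0 * (k * \<epsilon>) powr (m - s) \<le> (s - 1) / 2 \<and> C * \<epsilon> powr (p + q - (s - 1)) \<le> 1"
    using exists_parameters[OF n(1) assms(3,9,10,11), of "g 0"] by blast
  obtain C where C: "C \<ge> 0"
    "\<And>\<epsilon> (x::real^'n). \<epsilon> \<ge> 0 \<Longrightarrow> ext_conv \<alpha> p (\<lambda>x. \<epsilon> * norm x powr (- k)) x \<le> C * \<epsilon> powr p"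
    using ext_conv_power_bounded[where 'a = "real^'n", of \<alpha> k p] assms(1,3) n(2) k(2) unfolding n_def by blast
  obtain \<epsilon> where \<epsilon>: "\<epsilon> > 0" "(m - 1) * g 0 * (k * \<epsilon>) powr (m - s) \<le> (s - 1) / 2"
      "C * \<epsilon> powr (p + q - (s - 1)) \<le> 1"
    using ex by blast
  define \<Omega> where "\<Omega> = - cball (0::real^'n) 1"
  have \<Omega>: "open \<Omega>" "0 \<notin> \<Omega>" "\<And>x. x \<in> \<Omega> \<longleftrightarrow> norm x > 1" by (auto simp: \<Omega>_def)
  define T where "T r = k * \<epsilon> * r powr (- k - 1)" for r
  define H where "H r = (T r powr (s - 1) - g (T r) * T r powr (m - 1)) / r" for r
  define H' where "H' r = (- (k + 1) * ((s - 1) * T r powr (s - 1) - D (T r) * T r powr m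
      - (m - 1) * g (T r) * T r powr (m - 1)) - (T r powr (s - 1) - g (T r) * T r powr (m - 1))) / r\<^sup>2" for r
  have H: "\<And>r. r > 0 \<Longrightarrow> (H has_real_derivative H' r) (at r)" "continuous_on {0<..} H'"
    using power_solution_flux[where k = k and \<epsilon> = \<epsilon> and g = g and D = D and s = s and m = m] k(1) \<epsilon>(1) D
    unfolding H_def[abs_def] H'_def[abs_def] T_def by auto
  define u where "u x = \<epsilon> * norm x powr (- k)" for x :: "real^'n"
  define Du where "Du x = - (T (norm x) / norm x) *\<^sub>R x" for x :: "real^'n"
  have contT: "continuous_on {0<..} T" unfolding T_def[abs_def] by (auto intro!: continuous_intros)
  have T: "T r > 0" if "r > 0" for r using that k \<epsilon> by (simp add: T_def)
  have u: "(u has_derivative (\<lambda>h. Du x \<bullet> h)) (at x)" if "x \<in> \<Omega>" for x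
  proof -
    have x: "x \<noteq> 0" using that \<Omega> by auto
    have "((\<lambda>r. \<epsilon> * r powr (- k)) has_real_derivative - T (norm x)) (at (norm x))"
      using x by (auto intro!: derivative_eq_intros simp: T_def)
    from has_derivative_radial[OF this x] show ?thesis by (simp add: u_def[abs_def] Du_def)
  qed
  have contu: "continuous_on \<Omega> u"
    using u by (meson continuous_at_imp_continuous_on has_derivative_continuous)
  have contDu: "continuous_on \<Omega> Du"
    unfolding Du_def[abs_def] using \<Omega>(2)
    by (intro continuous_intros continuous_on_radial[OF contT]) auto
  have W1: "W1_loc m \<Omega> u Du"
    unfolding W1_loc_def using \<Omega>(1) contu contDu u assms(9,10)
    by (auto intro!: L_loc_continuous weak_gradient_C1)
  \<comment> \<open>The sign alone is recorded as a second fact: it makes the majorant nonnegative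
    when the integrals are compared.\<close>
  have div: "norm x * H' (norm x) + n * H (norm x) \<le> - (ext_conv \<alpha> p u x * u x powr q)"
    "norm x * H' (norm x) + n * H (norm x) \<le> 0" if x: "x \<in> \<Omega>" for x
  proof -
    define r where "r = norm x"
    define t where "t = T r"
    have r: "r > 1" using x \<Omega>(3) by (simp add: r_def)
    have t: "t > 0" using T r by (simp add: t_def)
    have "r powr (- k - 1) \<le> r powr 0" using r k by (intro powr_mono) auto
    then have tk: "t \<le> k * \<epsilon>" using r k \<epsilon> by (simp add: t_def T_def)
    have small: "(m - 1) * g 0 * t powr (m - s) \<le> (s - 1) / 2"
    proof -
      have "t powr (m - s) \<le> (k * \<epsilon>) powr (m - s)"
        using t tk assms(10) by (intro powr_mono2) auto
      then have "(m - 1) * g 0 * t powr (m - s) \<le> (m - 1) * g 0 * (k * \<epsilon>) powr (m - s)"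
        using assms(4)[of 0] assms(9,10) by (intro mult_left_mono) auto
      then show ?thesis using \<epsilon>(2) by linarith
    qed
    have "g t \<le> g 0" using monotone_onD[OF assms(5), of 0 t] t by auto
    moreover have "D t \<le> 0" by (rule antimono_on_imp_deriv_nonpos[OF assms(5) t D(1)[OF t]])
    ultimately have dom: "(k + 1) * ((s - 1) * t powr (s - 1) - D t * t powr m - (m - 1) * g t * t powr (m - 1))
        - (n - 1) * (t powr (s - 1) - g t * t powr (m - 1)) \<ge> t powr (s - 1)" (is "?dom \<ge> _")
      using assms(4,9,10) t k n by (intro s_term_dominates[OF _ _ _ _ _ _ small]) auto
    \<comment> \<open>The denominator r in \<open>H\<close> contributes -H to r H', which turns the
      factor n into n - 1.\<close>
    have "r * H' r + n * H r = - (?dom / r)"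
      using r unfolding H'_def H_def t_def[symmetric] by (simp add: power2_eq_square field_simps)
    then have le: "r * H' r + n * H r \<le> - (t powr (s - 1) / r)"
      using dom r divide_right_mono[of "t powr (s - 1)" ?dom r] by linarith
    also have "\<dots> \<le> - (C * \<epsilon> powr p * u x powr q)"
    proof -
      \<comment> \<open>The power \<epsilon>^(p+q) is split so that one factor absorbs
        \<open>C\<close> and the other, \<epsilon>^(s-1), has the order of t^(s-1).\<close>
      have "C * \<epsilon> powr p * u x powr q = C * \<epsilon> powr (p + q - (s - 1)) * (\<epsilon> powr (s - 1) * r powr (- (k * q)))"
        using \<epsilon>(1) r by (simp add: u_def r_def powr_mult powr_powr powr_add powr_diff)
      also have "\<dots> \<le> 1 * (\<epsilon> powr (s - 1) * r powr (- (k * q)))"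
        using \<epsilon>(3) by (intro mult_right_mono) auto
      \<comment> \<open>Here k \<ge> 1 compares the bases, and the decay condition compares the
        exponents of r > 1.\<close>
      also have "\<dots> \<le> (k * \<epsilon>) powr (s - 1) * r powr (- ((k + 1) * (s - 1) + 1))"
        using k \<epsilon>(1) r assms(9) mult_right_mono[OF k(1), of \<epsilon>]
        by (auto intro!: mult_mono powr_mono powr_mono2)
      also have "\<dots> = t powr (s - 1) / r"
      proof -
        have e: "- ((k + 1) * (s - 1) + 1) = (- k - 1) * (s - 1) - 1" by (simp add: algebra_simps)
        have "t powr (s - 1) = (k * \<epsilon>) powr (s - 1) * r powr ((- k - 1) * (s - 1))"
          unfolding t_def T_def using k \<epsilon>(1) r by (subst powr_mult) (simp_all only: powr_powr powr_ge_zero)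
        then show ?thesis
          unfolding e powr_diff[of r _ 1] using r by simp
      qed
      finally show ?thesis by simp
    qed
    also have "\<dots> \<le> - (ext_conv \<alpha> p u x * u x powr q)"
      using C(2)[of \<epsilon> x] \<epsilon>(1) by (auto simp: u_def[abs_def] intro!: mult_right_mono)
    finally show "norm x * H' (norm x) + n * H (norm x) \<le> - (ext_conv \<alpha> p u x * u x powr q)"
      by (simp add: r_def)
    have "t powr (s - 1) / r \<ge> 0" using r by simp
    then show "norm x * H' (norm x) + n * H (norm x) \<le> 0"
      using le unfolding r_def by linarith
  qed
  \<comment> \<open>\<open>Du\<close> points towards the origin, so the minus sign reverses the
    difference and the s-term appears in \<open>H\<close> with a plus.\<close>
  have flux: "(norm (Du x) powr (m - 2) * g (norm (Du x)) - norm (Du x) powr (s - 2)) * (Du x \<bullet> v)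
      = H (norm x) * (x \<bullet> v)" if x: "x \<in> \<Omega>" for x v
  proof -
    define t where "t = T (norm x)"
    have r: "norm x > 0" "x \<noteq> 0" using x \<Omega>(2) by auto
    have t: "t > 0" using T r by (simp add: t_def)
    have nD: "norm (Du x) = t" using t r by (simp add: Du_def t_def)
    have e: "t powr (m - 2) = t powr (m - 1) / t" "t powr (s - 2) = t powr (s - 1) / t"
      using t powr_diff[of t "m - 1" 1] powr_diff[of t "s - 1" 1] by simp_all
    show ?thesis
      unfolding nD e unfolding H_def t_def[symmetric] Du_def using t r by (simp add: field_simps)
  qed
  have ineq: "(LINT x:(- ball 0 1)|lebesgue.
             (norm (Du x) powr (m - 2) * g (norm (Du x)) - norm (Du x) powr (s - 2))
               * (Du x \<bullet> gradient \<phi> x))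
          \<ge> (LINT x:(- ball 0 1)|lebesgue. ext_conv \<alpha> p u x * u x powr q * \<phi> x)"
    if test: "test_function \<Omega> \<phi>" and nonneg: "\<And>x. \<phi> x \<ge> 0" for \<phi>
  proof -
    note \<phi> = test_functionD[OF test]
    have zero: "\<phi> x = 0" "gradient \<phi> x = 0" if "x \<notin> \<Omega>" for x
      using that \<phi>(5) \<phi>(6,7)[of x] by auto
    have zero': "\<phi> x = 0" "gradient \<phi> x = 0" if "x \<notin> - ball 0 1" for x
      using that by (auto intro!: zero simp: \<Omega>(3))
    note div' = radial_field_divergence[OF \<Omega>(1,2) test H, folded n_def]
    have "(LINT x:(- ball 0 1)|lebesgue. ext_conv \<alpha> p u x * u x powr q * \<phi> x)
        = (LINT x|lebesgue. ext_conv \<alpha> p u x * u x powr q * \<phi> x)"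
      by (rule set_integral_supported) (simp add: zero')
    also have "\<dots> \<le> (LINT x|lebesgue. - (\<phi> x * (norm x * H' (norm x) + n * H (norm x))))"
    \<comment> \<open>Again only the majorant needs to be integrable, so the convolution enters
      through its pointwise bound alone.\<close>
    proof (rule integral_mono')
      show "integrable lebesgue (\<lambda>x. - (\<phi> x * (norm x * H' (norm x) + n * H (norm x))))"
        using div'(1) by simp
      fix x :: "real^'n"
      show "ext_conv \<alpha> p u x * u x powr q * \<phi> x \<le> - (\<phi> x * (norm x * H' (norm x) + n * H (norm x)))"
      proof (cases "x \<in> \<Omega>")
        case True
        from mult_left_mono[OF div(1)[OF this] nonneg[of x]] show ?thesis by (simp add: mult_ac)
      qed (simp add: zero)
      show "0 \<le> - (\<phi> x * (norm x * H' (norm x) + n * H (norm x)))"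
      proof (cases "x \<in> \<Omega>")
        case True
        from mult_left_mono[OF div(2)[OF this] nonneg[of x]] show ?thesis by simp
      qed (simp add: zero)
    qed
    also have "\<dots> = (LINT x|lebesgue. H (norm x) * (x \<bullet> gradient \<phi> x))"
      using div' by simp
    also have "\<dots> = (LINT x|lebesgue. (norm (Du x) powr (m - 2) * g (norm (Du x)) - norm (Du x) powr (s - 2))
               * (Du x \<bullet> gradient \<phi> x))"
      using flux zero by (intro Bochner_Integration.integral_cong) (metis inner_zero_right mult_zero_right)+
    also have "\<dots> = (LINT x:(- ball 0 1)|lebesgue.
        (norm (Du x) powr (m - 2) * g (norm (Du x)) - norm (Du x) powr (s - 2)) * (Du x \<bullet> gradient \<phi> x))"
      by (rule set_integral_supported[symmetric]) (simp add: zero')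
    finally show ?thesis .
  qed
  \<comment> \<open>The weight is at most 1, and \<epsilon>^p |y|^(-kp) is integrable outside the
    unit ball because kp > N.\<close>
  have int: "set_integrable lebesgue (- ball 0 1) (\<lambda>y. u y powr p / (1 + norm y powr \<alpha>))"
    unfolding set_integrable_def
  proof (rule Bochner_Integration.integrable_bound)
    have "integrable lborel (\<lambda>y::real^'n. \<epsilon> powr p * (indicator (- ball 0 1) y * norm y powr (- (k * p))))"
      using k(2) unfolding n_def by (intro integrable_mult_right integrable_norm_powr_outside_ball)
    from integrable_completion[OF borel_measurable_integrable[OF this], THEN iffD2, OF this]
    show "integrable lebesgue (\<lambda>y::real^'n. \<epsilon> powr p * (indicator (- ball 0 1) y * norm y powr (- (k * p))))" .
    have "(\<lambda>y. indicator (- ball 0 1) y *\<^sub>R (u y powr p / (1 + norm y powr \<alpha>))) \<in> borel_measurable borel"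
      unfolding u_def
      by (intro borel_measurable_scaleR borel_measurable_indicator borel_measurable_divide powr_real_measurable
          borel_measurable_times borel_measurable_add borel_measurable_const borel_measurable_norm
          measurable_ident_sets borel_closed) auto
    then show "(\<lambda>y. indicator (- ball 0 1) y *\<^sub>R (u y powr p / (1 + norm y powr \<alpha>))) \<in> borel_measurable lebesgue"
      by (intro measurable_completion) simp
    have "u y powr p / (1 + norm y powr \<alpha>) \<le> \<epsilon> powr p * norm y powr (- (k * p))" for y
    proof -
      have "u y powr p / (1 + norm y powr \<alpha>) \<le> u y powr p / 1"
        by (intro divide_left_mono) (auto simp: add_pos_nonneg)
      then show ?thesis using \<epsilon>(1) by (simp add: u_def powr_mult powr_powr)
    qed
    moreover have "0 \<le> u y powr p / (1 + norm y powr \<alpha>)" for y by simp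
    ultimately show "AE y in lebesgue. norm (indicator (- ball 0 1) y *\<^sub>R (u y powr p / (1 + norm y powr \<alpha>)))
        \<le> norm (\<epsilon> powr p * (indicator (- ball 0 1) y * norm y powr (- (k * p))))"
      by (intro AE_I2) (auto simp: indicator_def abs_mult)
  qed
  show ?thesis
    unfolding positive_solution_def \<Omega>_def[symmetric]
  proof (intro exI[of _ u] conjI exI[of _ Du] allI impI ballI contu int W1)
    show "u x > 0" if "x \<in> \<Omega>" for x
    proof -
      have "x \<noteq> 0" using that \<Omega>(2) by auto
      then show ?thesis using \<epsilon>(1) by (simp add: u_def)
    qed
  qed (use ineq in auto)
qed

end
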